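(* Let $\Phi$ be a domain with $|\Phi|=n$, and let $\Sigma=\{\wedge,\veebar,\vee\}$ or $\Sigma=\{\wedge,\veebar,\mathbin{\dot\vee}\}$. Then the class of $\Phi$-teams of odd cardinality is definable by a $\mathrm{PL}(\Sigma)$-formula of length $2^{O(n)}$, and so is the class of $\Phi$-teams of even cardinality (a formula $\varphi$ defines a class $P$ of $\Phi$-teams if for every $\Phi$-team $T$: $T\models\varphi$ iff $T\in P$).
   Context: A domain $\Phi$ is a finite set of propositional variables; a $\Phi$-assignment is a map $s:\Phi\to\{0,1\}$; a $\Phi$-team is a (possibly empty) set of $\Phi$-assignments. A split of $T$ is $(T_1,T_2)$ with $T_1,T_2\subseteq T$, $T_1\cup T_2=T$; strict if $T_1\cap T_2=\emptyset$. $\mathrm{PL}(\Sigma)$ is the set of formulas built from the literals $\top,\bot,{\sim}\top,{\sim}\bot,p,\neg p,{\sim}p,{\sim}\neg p$ ($p\in\Phi$) by the connectives in $\Sigma$. Semantics: $T\models\top$ always; $T\models\bot$ iff $T=\emptyset$; $T\models p$ iff $s(p)=1$ for all $s\in T$; $T\models\neg p$ iff $s(p)=0$ for all $s\in T$; $T\models{\sim}\ell$ iff $T\not\models\ell$ for a literal $\ell$; $\wedge$ is conjunction; $T\models\psi\veebar\theta$ iff $T\models\psi$ or $T\models\theta$; $T\models\psi\vee\theta$ iff some split $(S,U)$ has $S\models\psi$, $U\models\theta$; $\mathbin{\dot\vee}$ likewise with strict splits. Length = length as a string, each variable counting as one symbol. *)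

theory Defs
  imports Complex_Main "HOL-Library.FuncSet" "HOL-Library.Landau_Symbols"
begin

text \<open>
  A \<open>\<Phi>\<close>-assignment is an extensional function (undefined outside \<open>\<Phi>\<close>), so that distinct
  functions are distinct maps on \<open>\<Phi>\<close> and \<^const>\<open>card\<close> gives the cardinality of a team;
  the truth values 1 and 0 are \<^const>\<open>True\<close> and \<^const>\<open>False\<close>.
\<close>

definition assignments :: "'a set \<Rightarrow> ('a \<Rightarrow> bool) set" where
  "assignments \<Phi> = \<Phi> \<rightarrow>\<^sub>E UNIV"

definition teams :: "'a set \<Rightarrow> ('a \<Rightarrow> bool) set set" where
  "teams \<Phi> = Pow (assignments \<Phi>)"

definition split :: "'b set \<Rightarrow> 'b set \<Rightarrow> 'b set \<Rightarrow> bool" where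
  "split T T1 T2 \<longleftrightarrow> T1 \<subseteq> T \<and> T2 \<subseteq> T \<and> T1 \<union> T2 = T"

definition strict_split :: "'b set \<Rightarrow> 'b set \<Rightarrow> 'b set \<Rightarrow> bool" where
  "strict_split T T1 T2 \<longleftrightarrow> split T T1 T2 \<and> T1 \<inter> T2 = {}"

text \<open>
  \<open>Lit l\<close> and \<open>CNeg l\<close> are the literals without and with the contradictory negation \<open>\<sim>\<close>.
  The connectives are, in order, \<open>\<and>\<close>, the Boolean disjunction (barred vee), the splitting
  disjunction \<open>\<or>\<close> and the strict splitting disjunction (dotted vee).
\<close>

datatype 'a literal = Top | Bot | Pos 'a | Neg 'a

datatype connective = Conj | BDisj | Disj | SDisj

datatype 'a formula =
    Lit "'a literal"
  | CNeg "'a literal"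
  | Bin connective "'a formula" "'a formula"

inductive_set PL :: "'a set \<Rightarrow> connective set \<Rightarrow> 'a formula set"
  for \<Phi> :: "'a set" and \<Sigma> :: "connective set" where
  Lit: "set_literal l \<subseteq> \<Phi> \<Longrightarrow> Lit l \<in> PL \<Phi> \<Sigma>"
| CNeg: "set_literal l \<subseteq> \<Phi> \<Longrightarrow> CNeg l \<in> PL \<Phi> \<Sigma>"
| Bin: "c \<in> \<Sigma> \<Longrightarrow> \<phi> \<in> PL \<Phi> \<Sigma> \<Longrightarrow> \<psi> \<in> PL \<Phi> \<Sigma> \<Longrightarrow> Bin c \<phi> \<psi> \<in> PL \<Phi> \<Sigma>"

fun sat_literal :: "('a \<Rightarrow> bool) set \<Rightarrow> 'a literal \<Rightarrow> bool" where
  "sat_literal T Top \<longleftrightarrow> True"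
| "sat_literal T Bot \<longleftrightarrow> T = {}"
| "sat_literal T (Pos p) \<longleftrightarrow> (\<forall>s\<in>T. s p)"
| "sat_literal T (Neg p) \<longleftrightarrow> (\<forall>s\<in>T. \<not> s p)"

fun sat :: "('a \<Rightarrow> bool) set \<Rightarrow> 'a formula \<Rightarrow> bool" where
  "sat T (Lit l) \<longleftrightarrow> sat_literal T l"
| "sat T (CNeg l) \<longleftrightarrow> \<not> sat_literal T l"
| "sat T (Bin Conj \<psi> \<theta>) \<longleftrightarrow> sat T \<psi> \<and> sat T \<theta>"
| "sat T (Bin BDisj \<psi> \<theta>) \<longleftrightarrow> sat T \<psi> \<or> sat T \<theta>"
| "sat T (Bin Disj \<psi> \<theta>) \<longleftrightarrow> (\<exists>S U. split T S U \<and> sat S \<psi> \<and> sat U \<theta>)"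
| "sat T (Bin SDisj \<psi> \<theta>) \<longleftrightarrow> (\<exists>S U. strict_split T S U \<and> sat S \<psi> \<and> sat U \<theta>)"

definition defines_class :: "'a set \<Rightarrow> 'a formula \<Rightarrow> ('a \<Rightarrow> bool) set set \<Rightarrow> bool" where
  "defines_class \<Phi> \<phi> P \<longleftrightarrow> (\<forall>T\<in>teams \<Phi>. sat T \<phi> \<longleftrightarrow> T \<in> P)"

text \<open>
  The string form of a formula puts brackets around each binary formula.
\<close>

datatype 'a symbol =
  STop | SBot | SVar 'a | SNeg | STilde | SConn connective | SOpen | SClose

fun literal_string :: "'a literal \<Rightarrow> 'a symbol list" where
  "literal_string Top = [STop]"
| "literal_string Bot = [SBot]"
| "literal_string (Pos p) = [SVar p]"
| "literal_string (Neg p) = [SNeg, SVar p]"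

fun formula_string :: "'a formula \<Rightarrow> 'a symbol list" where
  "formula_string (Lit l) = literal_string l"
| "formula_string (CNeg l) = STilde # literal_string l"
| "formula_string (Bin c \<phi> \<psi>) =
    [SOpen] @ formula_string \<phi> @ [SConn c] @ formula_string \<psi> @ [SClose]"

definition formula_length :: "'a formula \<Rightarrow> nat" where
  "formula_length \<phi> = length (formula_string \<phi>)"

definition odd_teams :: "'a set \<Rightarrow> ('a \<Rightarrow> bool) set set" where
  "odd_teams \<Phi> = {T \<in> teams \<Phi>. odd (card T)}"

definition even_teams :: "'a set \<Rightarrow> ('a \<Rightarrow> bool) set set" where
  "even_teams \<Phi> = {T \<in> teams \<Phi>. even (card T)}"

end

theory Submission imports Defs begin

text \<open>
  Fix a variable \<open>p\<close>. The only split of \<open>T\<close> into a part satisfying \<open>p\<close> and a part satisfying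
  \<open>\<not>p\<close> is the obvious one, and it is strict, so both splitting disjunctions can be used to
  speak about the two halves. The parity of \<open>T\<close> is determined by the parities of its halves, on
  which \<open>p\<close> is constant; recursion on the variables replaces each formula by four copies of formulas
  for one variable less, which gives length \<open>O(4\<^sup>n)\<close>.
\<close>

definition case_split :: "connective \<Rightarrow> 'a \<Rightarrow> 'a formula \<Rightarrow> 'a formula \<Rightarrow> 'a formula" where
  "case_split c p \<phi> \<psi> = Bin c (Bin Conj (Lit (Pos p)) \<phi>) (Bin Conj (Lit (Neg p)) \<psi>)"

text \<open>The flag \<open>b\<close> is \<open>True\<close> for odd and \<open>False\<close> for
  even. The two disjuncts guess the parity of the \<open>p\<close>-half; the other half must then
  have parity \<open>\<not> b\<close> or \<open>b\<close>. With no variables left the team has at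
  most one assignment, so odd means nonempty.\<close>

fun parity_formula :: "connective \<Rightarrow> 'a list \<Rightarrow> bool \<Rightarrow> 'a formula" where
  "parity_formula c [] b = (if b then CNeg Bot else Lit Bot)"
| "parity_formula c (p # ps) b =
    Bin BDisj (case_split c p (parity_formula c ps True) (parity_formula c ps (\<not> b)))
      (case_split c p (parity_formula c ps False) (parity_formula c ps b))"

lemma sat_case_split:
  assumes "c \<in> {Disj, SDisj}"
  shows "sat T (case_split c p \<phi> \<psi>) \<longleftrightarrow> sat {s \<in> T. s p} \<phi> \<and> sat {s \<in> T. \<not> s p} \<psi>"
proof
  assume "sat T (case_split c p \<phi> \<psi>)"
  then obtain S U where *: "split T S U" "\<forall>s\<in>S. s p" "sat S \<phi>" "\<forall>s\<in>U. \<not> s p" "sat U \<psi>"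
    using assms by (auto simp: case_split_def strict_split_def)
  \<comment> \<open>\<open>S\<close> and \<open>U\<close> cover \<open>T\<close>, and an assignment
    cannot lie in the part with the opposite value of \<open>p\<close>.\<close>
  then have "S = {s \<in> T. s p}" "U = {s \<in> T. \<not> s p}"
    unfolding split_def by blast+
  with * show "sat {s \<in> T. s p} \<phi> \<and> sat {s \<in> T. \<not> s p} \<psi>" by simp
next
  \<comment> \<open>The two halves are disjoint, so the same witness serves both
    connectives.\<close>
  have *: "strict_split T {s \<in> T. s p} {s \<in> T. \<not> s p}"
    unfolding strict_split_def split_def by blast
  then have **: "split T {s \<in> T. s p} {s \<in> T. \<not> s p}"
    unfolding strict_split_def by simp
  assume "sat {s \<in> T. s p} \<phi> \<and> sat {s \<in> T. \<not> s p} \<psi>"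
  with assms show "sat T (case_split c p \<phi> \<psi>)"
    using * ** by (fastforce simp: case_split_def)
qed

text \<open>The separation hypothesis is what the induction carries: on each half \<open>p\<close>
  is constant, so the variables in \<open>ps\<close> alone still separate its assignments.\<close>

lemma sat_parity_formula:
  assumes "c \<in> {Disj, SDisj}" "finite T"
    and "\<And>s t. \<lbrakk>s \<in> T; t \<in> T; \<forall>p\<in>set ps. s p = t p\<rbrakk> \<Longrightarrow> s = t"
  shows "sat T (parity_formula c ps b) \<longleftrightarrow> odd (card T) = b"
  using assms(2,3)
proof (induction ps arbitrary: T b)
  case Nil
  then have "\<And>s t. s \<in> T \<Longrightarrow> t \<in> T \<Longrightarrow> s = t" by simp
  then have "T = {} \<or> (\<exists>s. T = {s})" by blast
  then show ?case by auto
next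
  case (Cons p ps)
  let ?P = "{s \<in> T. s p}" and ?N = "{s \<in> T. \<not> s p}"
  have P: "sat ?P (parity_formula c ps b') \<longleftrightarrow> odd (card ?P) = b'" for b'
    by (rule Cons.IH) (use Cons.prems in auto)
  have N: "sat ?N (parity_formula c ps b') \<longleftrightarrow> odd (card ?N) = b'" for b'
    by (rule Cons.IH) (use Cons.prems in auto)
  have "card (?P \<union> ?N) = card ?P + card ?N"
    using Cons.prems(1) by (intro card_Un_disjoint) auto
  moreover have "?P \<union> ?N = T" by blast
  ultimately have "card T = card ?P + card ?N" by simp
  then show ?case
    by (cases b) (auto simp: sat_case_split[OF assms(1)] P N)
qed

lemma parity_formula_in_PL:
  assumes "{Conj, BDisj, c} \<subseteq> \<Sigma>" "set ps \<subseteq> \<Phi>"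
  shows "parity_formula c ps b \<in> PL \<Phi> \<Sigma>"
  using assms(2)
  by (induction ps arbitrary: b) (use assms(1) in \<open>auto simp: case_split_def intro!: PL.intros\<close>)

text \<open>One recursion step makes four copies and adds 27 symbols. The offset 9 = 27/3 turns
  \<open>4 * L + 27\<close> into exact multiplication by 4; the base case is at most 2 + 9 =
  11.\<close>

lemma length_parity_formula: "formula_length (parity_formula c ps b) + 9 \<le> 11 * 4 ^ length ps"
proof (induction ps arbitrary: b)
  case Nil
  show ?case by (simp add: formula_length_def)
next
  case (Cons p ps)
  show ?case
    using Cons.IH[of True] Cons.IH[of False]
    by (cases b) (simp_all add: formula_length_def case_split_def)
qed

lemma defines_class_parity_formula:
  assumes "c \<in> {Disj, SDisj}"
  shows "defines_class (set ps) (parity_formula c ps True) (odd_teams (set ps))"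
    and "defines_class (set ps) (parity_formula c ps False) (even_teams (set ps))"
proof -
  have "sat T (parity_formula c ps b) \<longleftrightarrow> odd (card T) = b" if "T \<in> teams (set ps)" for T b
  proof (rule sat_parity_formula[OF assms(1)])
    have T: "T \<subseteq> assignments (set ps)"
      using that by (simp add: teams_def)
    then show "finite T"
      by (rule finite_subset) (simp add: assignments_def finite_PiE)
    show "s = t" if "s \<in> T" "t \<in> T" and eq: "\<forall>p\<in>set ps. s p = t p" for s t
    \<comment> \<open>Extensionality: assignments are fixed outside \<open>set ps\<close>, so
      agreement on \<open>ps\<close> makes them equal.\<close>
    proof (rule PiE_ext)
      show "s \<in> set ps \<rightarrow>\<^sub>E UNIV" "t \<in> set ps \<rightarrow>\<^sub>E UNIV"
        using that T by (auto simp only: assignments_def)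
      show "s p = t p" if "p \<in> set ps" for p
        using that eq by simp
    qed
  qed
  then show "defines_class (set ps) (parity_formula c ps True) (odd_teams (set ps))"
    and "defines_class (set ps) (parity_formula c ps False) (even_teams (set ps))"
    by (auto simp: defines_class_def odd_teams_def even_teams_def)
qed

theorem theorem4p12:
  fixes \<Sigma> :: "connective set"
  assumes "\<Sigma> = {Conj, BDisj, Disj} \<or> \<Sigma> = {Conj, BDisj, SDisj}"
  shows "\<exists>g :: nat \<Rightarrow> real. g \<in> O(\<lambda>n. real n) \<and>
    (\<forall>(\<Phi> :: 'a set) n. finite \<Phi> \<and> card \<Phi> = n \<longrightarrow>
      (\<exists>\<phi>\<in>PL \<Phi> \<Sigma>. defines_class \<Phi> \<phi> (odd_teams \<Phi>) \<and>
          real (formula_length \<phi>) \<le> 2 powr g n) \<and>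
      (\<exists>\<phi>\<in>PL \<Phi> \<Sigma>. defines_class \<Phi> \<phi> (even_teams \<Phi>) \<and>
          real (formula_length \<phi>) \<le> 2 powr g n))"
proof -
  obtain c where c: "c \<in> {Disj, SDisj}" "{Conj, BDisj, c} \<subseteq> \<Sigma>"
    using assms by blast
  \<comment> \<open>Chosen so that \<open>2 powr g n\<close> is \<open>16 * 4 ^ n\<close>, rounding
    the factor 11 up to a power of 2.\<close>
  define g :: "nat \<Rightarrow> real" where "g n = real (2 * n + 4)" for n
  have "g \<in> O(\<lambda>n. real n)"
    \<comment> \<open>\<open>2 * n + 4 \<le> 6 * n\<close> holds from \<open>n = 1\<close>
      on.\<close>
    by (rule bigoI[of _ 6]) (auto simp: g_def intro!: eventually_sequentiallyI[of 1])
  moreover have "(\<exists>\<phi>\<in>PL \<Phi> \<Sigma>. defines_class \<Phi> \<phi> (odd_teams \<Phi>) \<and>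
          real (formula_length \<phi>) \<le> 2 powr g (card \<Phi>)) \<and>
      (\<exists>\<phi>\<in>PL \<Phi> \<Sigma>. defines_class \<Phi> \<phi> (even_teams \<Phi>) \<and>
          real (formula_length \<phi>) \<le> 2 powr g (card \<Phi>))" if fin: "finite \<Phi>" for \<Phi> :: "'a set"
  proof -
    \<comment> \<open>Distinctness gives \<open>length ps = card \<Phi>\<close>, which turns the
      length bound into one in \<open>card \<Phi>\<close>.\<close>
    obtain ps where ps: "set ps = \<Phi>" "distinct ps"
      using finite_distinct_list[OF fin] by blast
    have len: "real (formula_length (parity_formula c ps b)) \<le> 2 powr g (card \<Phi>)" for b
    proof -
      have "formula_length (parity_formula c ps b) \<le> 16 * 4 ^ card \<Phi>"
        using length_parity_formula[of c ps b] distinct_card[OF ps(2)] ps(1) by simp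
      also have "\<dots> = 2 ^ (2 * card \<Phi> + 4)"
        by (simp add: power_add power_mult)
      finally have "real (formula_length (parity_formula c ps b)) \<le> 2 ^ (2 * card \<Phi> + 4)"
        by (simp only: of_nat_le_numeral_power_cancel_iff)
      then show ?thesis
        unfolding g_def by (simp only: powr_realpow zero_less_numeral)
    qed
    have "parity_formula c ps b \<in> PL \<Phi> \<Sigma>" for b
      using c(2) ps(1) by (intro parity_formula_in_PL) auto
    then show ?thesis
      using defines_class_parity_formula[OF c(1), of ps] len fin ps(1) by blast
  qed
  ultimately show ?thesis by blast
qed

end
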